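(* For every description $(N,\preccurlyeq,F)$ of a simply dependent multimodal logic, the nested system $\mathsf{NS}_{(N,\preccurlyeq,F)}$ has the following properties: weakening is height-preserving admissible; all introduction rules are height-preserving invertible; and any pair of rules is permutable.
   Context: A description $(N,\preccurlyeq,F)$ consists of a finite set $N\subseteq\mathbb{N}$, a partial order $\preccurlyeq$ on $N$, and $F:N\to 2^{\{\mathsf{D},\mathsf{T},\mathsf{4}\}}$, which is transitive-closed: if $j\preccurlyeq i$ and $\mathsf{K4}\subseteq F(j)$ then $\mathsf{K4}\subseteq F(i)$. Formulae: classical propositional formulae with modalities $\Box_i$, $i\in N$. Write $\uparrow j=\{i\in N: j\preccurlyeq i\}$, $\uparrow^{\mathsf{Ax}}j=\{i\in\uparrow j:\mathsf{KAx}\subseteq F(i)\}$, $\uparrow^{\neg\mathsf{Ax}}j=\{i\in\uparrow j:\mathsf{KAx}\not\subseteq F(i)\}$. Indexed nested sequents: $\Gamma\vdash\Delta,[G_1]^{i_1},\ldots,[G_n]^{i_n}$ with $G_k$ indexed nested sequents and $i_k\in N$; $\Lambda$ denotes multisets of nestings, $\Upsilon\{\;\}$ a context with a hole. $\mathsf{NS}_{(N,\preccurlyeq,F)}$ consists of the usual classical context-sharing propositional sequent rules and axioms ($\Gamma,P\vdash P,\Delta$, $\Gamma,\bot\vdash\Delta$) applied inside any component (as $\Upsilon\{\Gamma\vdash\Delta,\Lambda\}$), plus: $\Box_{iR}$ (all $i$): $\Upsilon\{\Gamma\vdash\Delta,\Box_iA,\Lambda\}$ from $\Upsilon\{\Gamma\vdash\Delta,[\;\vdash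 A]^i,\Lambda\}$; $\Box_{ijL}$ ($i\in\uparrow j$): $\Upsilon\{\Gamma,\Box_iA\vdash\Delta,[\Sigma\vdash\Pi]^j,\Lambda\}$ from $\Upsilon\{\Gamma,\Box_iA\vdash\Delta,[\Sigma,A\vdash\Pi]^j,\Lambda\}$; $\mathsf{d}_{ij}$ ($i\in\uparrow^{\mathsf{D}}j$): $\Upsilon\{\Gamma,\Box_iA\vdash\Delta,\Lambda\}$ from $\Upsilon\{\Gamma,\Box_iA\vdash\Delta,[A\vdash\;]^j,\Lambda\}$; $\mathsf{t}_i$ ($\mathsf{KT}\subseteq F(i)$): $\Upsilon\{\Gamma,\Box_iA\vdash\Delta,\Lambda\}$ from $\Upsilon\{\Gamma,\Box_iA,A\vdash\Delta,\Lambda\}$; $\mathsf{4}_{ij}$ ($i\in\uparrow^{\mathsf{4}}j$): $\Upsilon\{\Gamma,\Box_iA\vdash\Delta,[\Sigma\vdash\Pi]^j,\Lambda\}$ from $\Upsilon\{\Gamma,\Box_iA\vdash\Delta,[\Sigma,\Box_iA\vdash\Pi]^j,\Lambda\}$. Two rules are permutable if each permutes down the other: $r_2$ permutes down $r_1$ if whenever $r_1$ acts on $S$ and $r_2$ on premises of $r_1$ (not on auxiliary formulae or nestings created by $r_1$'s principal formula) there is a derivation of $S$ where $r_2$ acts on $S$ and $r_1$ on zero or more of its premises (not on $r_2$'s auxiliary structures). *)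

theory Defs
  imports "HOL-Library.Multiset"
begin

section \<open>Descriptions and formulae\<close>

datatype modal_axiom = D_ax | T_ax | Four_ax

text \<open>A pair \<open>(j, i) \<in> le\<close> stands for \<open>j \<preceq> i\<close>. Since \<open>F i\<close> lists the axioms
  that are added to K, the condition that KAx is contained in \<open>F i\<close> is \<open>Ax \<in> F i\<close>.\<close>

definition transitive_closed ::
  "nat set \<Rightarrow> nat rel \<Rightarrow> (nat \<Rightarrow> modal_axiom set) \<Rightarrow> bool" where
  "transitive_closed N le F \<longleftrightarrow>
     (\<forall>j\<in>N. \<forall>i\<in>N. (j, i) \<in> le \<and> Four_ax \<in> F j \<longrightarrow> Four_ax \<in> F i)"

definition description ::
  "nat set \<Rightarrow> nat rel \<Rightarrow> (nat \<Rightarrow> modal_axiom set) \<Rightarrow> bool" where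
  "description N le F \<longleftrightarrow> finite N \<and> partial_order_on N le \<and> transitive_closed N le F"

definition up :: "nat set \<Rightarrow> nat rel \<Rightarrow> nat \<Rightarrow> nat set" where
  "up N le j = {i \<in> N. (j, i) \<in> le}"

definition up_ax ::
  "nat set \<Rightarrow> nat rel \<Rightarrow> (nat \<Rightarrow> modal_axiom set) \<Rightarrow> modal_axiom \<Rightarrow> nat \<Rightarrow> nat set" where
  "up_ax N le F a j = {i \<in> up N le j. a \<in> F i}"

text \<open>Negation is \<open>Imp A Bot\<close>.\<close>

datatype fm =
    Atom nat
  | Bot
  | And fm fm
  | Or fm fm
  | Imp fm fm
  | Box nat fm

primrec indices :: "fm \<Rightarrow> nat set" where
  "indices (Atom p) = {}"
| "indices Bot = {}"
| "indices (And A B) = indices A \<union> indices B"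
| "indices (Or A B) = indices A \<union> indices B"
| "indices (Imp A B) = indices A \<union> indices B"
| "indices (Box i A) = insert i (indices A)"


section \<open>Indexed nested sequents\<close>

text \<open>\<open>Seq \<Gamma> \<Delta> \<Lambda>\<close> is \<open>\<Gamma> \<turnstile> \<Delta>, \<Lambda>\<close>. The type is polymorphic so that the same
  constructions serve for plain nested sequents and for sequents whose formula and nesting
  occurrences carry tags.\<close>

datatype ('f, 'x) nseq =
  Seq "'f multiset" "'f multiset" "('x \<times> ('f, 'x) nseq) multiset"

type_synonym seq = "(fm, nat) nseq"

definition wf_seq :: "nat set \<Rightarrow> seq \<Rightarrow> bool" where
  "wf_seq N S \<longleftrightarrow> (\<forall>A \<in> set1_nseq S. indices A \<subseteq> N) \<and> set2_nseq S \<subseteq> N"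

datatype ('f, 'x) ctx =
    Hole
  | Under "'f multiset" "'f multiset" "('x \<times> ('f, 'x) nseq) multiset" 'x "('f, 'x) ctx"

primrec fill :: "('f, 'x) ctx \<Rightarrow> ('f, 'x) nseq \<Rightarrow> ('f, 'x) nseq" where
  "fill Hole S = S"
| "fill (Under \<Gamma> \<Delta> \<Lambda> x U) S = Seq \<Gamma> \<Delta> (add_mset (x, fill U S) \<Lambda>)"

primrec path :: "('f, 'x) ctx \<Rightarrow> 'x list" where
  "path Hole = []"
| "path (Under \<Gamma> \<Delta> \<Lambda> x U) = x # path U"


section \<open>Rules\<close>

text \<open>Occurrences in a conclusion are tagged \<open>Orig k\<close>; the auxiliary formulae and the
  nestings created by a rule application are tagged \<open>Aux\<close>, and context occurrences keep
  their tag. A rule application acts on \<open>Orig\<close> occurrences only, so that an application to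
  a premise that is again possible in the tagged calculus does not act on auxiliary formulae
  or newly created nestings. The copy of the principal formula kept by the modal left rules
  is not auxiliary.\<close>

datatype tag = Orig nat | Aux

type_synonym tseq = "(fm \<times> tag, nat \<times> tag) nseq"

definition erase :: "tseq \<Rightarrow> seq" where
  "erase T = map_nseq fst fst T"

definition all_orig :: "tseq \<Rightarrow> bool" where
  "all_orig T \<longleftrightarrow> Aux \<notin> snd ` set1_nseq T \<and> Aux \<notin> snd ` set2_nseq T"

datatype ns_rule =
    Init
  | BotL
  | AndL | AndR
  | OrL | OrR
  | ImpL | ImpR
  | BoxR nat
  | BoxL nat nat
  | DRule nat nat
  | TRule nat
  | FourRule nat nat

text \<open>\<open>local_rule r ks C Cs\<close>: rule \<open>r\<close> at a single component, with conclusion \<open>C\<close> and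
  premises \<open>Cs\<close>. The list \<open>ks\<close> records the labels of the occurrences acted upon: the
  principal formulae and, for the two rules moving formulae into a nesting, that nesting.
  The nesting moved into may itself contain nestings \<open>\<Theta>\<close>. Initial sequents are restricted
  to propositional variables, as height-preserving invertibility requires.\<close>

inductive local_rule :: "ns_rule \<Rightarrow> nat list \<Rightarrow> tseq \<Rightarrow> tseq list \<Rightarrow> bool" where
  init: "local_rule Init [k, l]
    (Seq (add_mset (Atom p, Orig k) \<Gamma>) (add_mset (Atom p, Orig l) \<Delta>) \<Lambda>) []"
| botL: "local_rule BotL [k]
    (Seq (add_mset (Bot, Orig k) \<Gamma>) \<Delta> \<Lambda>) []"
| andL: "local_rule AndL [k]
    (Seq (add_mset (And A B, Orig k) \<Gamma>) \<Delta> \<Lambda>)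
    [Seq (add_mset (A, Aux) (add_mset (B, Aux) \<Gamma>)) \<Delta> \<Lambda>]"
| andR: "local_rule AndR [k]
    (Seq \<Gamma> (add_mset (And A B, Orig k) \<Delta>) \<Lambda>)
    [Seq \<Gamma> (add_mset (A, Aux) \<Delta>) \<Lambda>, Seq \<Gamma> (add_mset (B, Aux) \<Delta>) \<Lambda>]"
| orL: "local_rule OrL [k]
    (Seq (add_mset (Or A B, Orig k) \<Gamma>) \<Delta> \<Lambda>)
    [Seq (add_mset (A, Aux) \<Gamma>) \<Delta> \<Lambda>, Seq (add_mset (B, Aux) \<Gamma>) \<Delta> \<Lambda>]"
| orR: "local_rule OrR [k]
    (Seq \<Gamma> (add_mset (Or A B, Orig k) \<Delta>) \<Lambda>)
    [Seq \<Gamma> (add_mset (A, Aux) (add_mset (B, Aux) \<Delta>)) \<Lambda>]"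
| impL: "local_rule ImpL [k]
    (Seq (add_mset (Imp A B, Orig k) \<Gamma>) \<Delta> \<Lambda>)
    [Seq \<Gamma> (add_mset (A, Aux) \<Delta>) \<Lambda>, Seq (add_mset (B, Aux) \<Gamma>) \<Delta> \<Lambda>]"
| impR: "local_rule ImpR [k]
    (Seq \<Gamma> (add_mset (Imp A B, Orig k) \<Delta>) \<Lambda>)
    [Seq (add_mset (A, Aux) \<Gamma>) (add_mset (B, Aux) \<Delta>) \<Lambda>]"
| boxR: "local_rule (BoxR i) [k]
    (Seq \<Gamma> (add_mset (Box i A, Orig k) \<Delta>) \<Lambda>)
    [Seq \<Gamma> \<Delta> (add_mset ((i, Aux), Seq {#} {#(A, Aux)#} {#}) \<Lambda>)]"
| boxL: "local_rule (BoxL i j) [k, l]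
    (Seq (add_mset (Box i A, Orig k) \<Gamma>) \<Delta> (add_mset ((j, Orig l), Seq \<Sigma> \<Pi> \<Theta>) \<Lambda>))
    [Seq (add_mset (Box i A, Orig k) \<Gamma>) \<Delta>
       (add_mset ((j, Orig l), Seq (add_mset (A, Aux) \<Sigma>) \<Pi> \<Theta>) \<Lambda>)]"
| d: "local_rule (DRule i j) [k]
    (Seq (add_mset (Box i A, Orig k) \<Gamma>) \<Delta> \<Lambda>)
    [Seq (add_mset (Box i A, Orig k) \<Gamma>) \<Delta>
       (add_mset ((j, Aux), Seq {#(A, Aux)#} {#} {#}) \<Lambda>)]"
| t: "local_rule (TRule i) [k]
    (Seq (add_mset (Box i A, Orig k) \<Gamma>) \<Delta> \<Lambda>)
    [Seq (add_mset (A, Aux) (add_mset (Box i A, Orig k) \<Gamma>)) \<Delta> \<Lambda>]"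
| four: "local_rule (FourRule i j) [k, l]
    (Seq (add_mset (Box i A, Orig k) \<Gamma>) \<Delta> (add_mset ((j, Orig l), Seq \<Sigma> \<Pi> \<Theta>) \<Lambda>))
    [Seq (add_mset (Box i A, Orig k) \<Gamma>) \<Delta>
       (add_mset ((j, Orig l), Seq (add_mset (Box i A, Aux) \<Sigma>) \<Pi> \<Theta>) \<Lambda>)]"

definition ns_rules ::
  "nat set \<Rightarrow> nat rel \<Rightarrow> (nat \<Rightarrow> modal_axiom set) \<Rightarrow> ns_rule set" where
  "ns_rules N le F =
     {Init, BotL, AndL, AndR, OrL, OrR, ImpL, ImpR}
     \<union> {BoxR i | i. i \<in> N}
     \<union> {BoxL i j | i j. j \<in> N \<and> i \<in> up N le j}
     \<union> {DRule i j | i j. j \<in> N \<and> i \<in> up_ax N le F D_ax j}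
     \<union> {TRule i | i. i \<in> N \<and> T_ax \<in> F i}
     \<union> {FourRule i j | i j. j \<in> N \<and> i \<in> up_ax N le F Four_ax j}"

definition introduction_rules ::
  "nat set \<Rightarrow> nat rel \<Rightarrow> (nat \<Rightarrow> modal_axiom set) \<Rightarrow> ns_rule set" where
  "introduction_rules N le F = ns_rules N le F - {Init, BotL}"

text \<open>Rule \<open>r\<close> acts on \<open>T\<close> with premises \<open>Ts\<close>; \<open>ms\<close> are the labels of the nestings leading
  to the component it is applied in, \<open>ks\<close> those of the occurrences it acts upon there.\<close>

inductive tagged_app ::
  "ns_rule \<Rightarrow> nat list \<Rightarrow> nat list \<Rightarrow> tseq \<Rightarrow> tseq list \<Rightarrow> bool" where
  "local_rule r ks C Cs \<Longrightarrow> map snd (path U) = map Orig ms \<Longrightarrow>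
     tagged_app r ms ks (fill U C) (map (fill U) Cs)"

definition acts :: "ns_rule \<Rightarrow> seq \<Rightarrow> seq list \<Rightarrow> bool" where
  "acts r S Ps \<longleftrightarrow>
     (\<exists>ms ks T Ts. tagged_app r ms ks T Ts \<and> S = erase T \<and> Ps = map erase Ts)"

text \<open>\<open>derives N le F n S\<close>: \<open>S\<close> has a derivation of height at most \<open>n\<close>.\<close>

inductive derives ::
  "nat set \<Rightarrow> nat rel \<Rightarrow> (nat \<Rightarrow> modal_axiom set) \<Rightarrow> nat \<Rightarrow> seq \<Rightarrow> bool"
  for N le F where
  "\<lbrakk>wf_seq N S; r \<in> ns_rules N le F; acts r S Ps; \<And>P. P \<in> set Ps \<Longrightarrow> derives N le F n P\<rbrakk>
     \<Longrightarrow> derives N le F (Suc n) S"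

definition derivable ::
  "nat set \<Rightarrow> nat rel \<Rightarrow> (nat \<Rightarrow> modal_axiom set) \<Rightarrow> seq \<Rightarrow> bool" where
  "derivable N le F S \<longleftrightarrow> (\<exists>n. derives N le F n S)"


section \<open>Admissibility, invertibility and permutability\<close>

inductive weakening :: "seq \<Rightarrow> seq \<Rightarrow> bool" where
  "weakening (fill U (Seq \<Gamma> \<Delta> \<Lambda>)) (fill U (Seq (\<Gamma> + \<Gamma>') (\<Delta> + \<Delta>') (\<Lambda> + \<Lambda>')))"

definition weakening_hp_admissible ::
  "nat set \<Rightarrow> nat rel \<Rightarrow> (nat \<Rightarrow> modal_axiom set) \<Rightarrow> bool" where
  "weakening_hp_admissible N le F \<longleftrightarrow>
     (\<forall>n S S'. weakening S S' \<and> wf_seq N S' \<and> derives N le F n S \<longrightarrow> derives N le F n S')"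

definition hp_invertible ::
  "nat set \<Rightarrow> nat rel \<Rightarrow> (nat \<Rightarrow> modal_axiom set) \<Rightarrow> ns_rule \<Rightarrow> bool" where
  "hp_invertible N le F r \<longleftrightarrow>
     (\<forall>n S Ps. acts r S Ps \<and> derives N le F n S \<longrightarrow> (\<forall>P \<in> set Ps. derives N le F n P))"

text \<open>The tagged sequent \<open>T\<close> ranges over all labellings of a nested sequent, injective ones
  included, so that the permuted applications of \<open>r1\<close> and \<open>r2\<close> act on the same occurrences
  as the original ones. In the new derivation \<open>r1\<close> acts on every premise of \<open>r2\<close>, of which
  there are zero, one or two.\<close>

definition permutes_down ::
  "nat set \<Rightarrow> nat rel \<Rightarrow> (nat \<Rightarrow> modal_axiom set) \<Rightarrow> ns_rule \<Rightarrow> ns_rule \<Rightarrow> bool" where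
  "permutes_down N le F r2 r1 \<longleftrightarrow>
     (\<forall>T Ps ms1 ks1 ms2 ks2.
        wf_seq N (erase T) \<and> all_orig T \<and>
        tagged_app r1 ms1 ks1 T Ps \<and> (\<forall>P \<in> set Ps. derivable N le F (erase P)) \<and>
        (\<exists>P \<in> set Ps. \<exists>Qs. tagged_app r2 ms2 ks2 P Qs \<and>
           (\<forall>Q \<in> set Qs. derivable N le F (erase Q)))
        \<longrightarrow>
        (\<exists>Qs. tagged_app r2 ms2 ks2 T Qs \<and>
           (\<forall>Q \<in> set Qs. derivable N le F (erase Q) \<and>
              (\<exists>Rs. tagged_app r1 ms1 ks1 Q Rs \<and>
                 (\<forall>R \<in> set Rs. derivable N le F (erase R))))))"

definition permutable ::
  "nat set \<Rightarrow> nat rel \<Rightarrow> (nat \<Rightarrow> modal_axiom set) \<Rightarrow> ns_rule \<Rightarrow> ns_rule \<Rightarrow> bool" where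
  "permutable N le F r1 r2 \<longleftrightarrow> permutes_down N le F r2 r1 \<and> permutes_down N le F r1 r2"

end

theory Submission
  imports Defs
begin

text \<open>Componentwise union makes nested sequents a cancellative commutative monoid, in which a rule
  rewrites \<open>B + C\<close> to \<open>B + w\<close> inside a context. An application to \<open>U{B + u}\<close> that does not consume
  \<open>u\<close> is uniform in \<open>u\<close>: it remains possible at the same place, with corresponding premises, when
  \<open>u\<close> is replaced by any \<open>v\<close>. With \<open>u = 0\<close> this gives weakening; with \<open>u\<close> the principal formula
  and \<open>v\<close> an auxiliary part it gives invertibility of the rules that consume their principal
  formula, while the modal left rules are inverted by weakening. For permutability, \<open>u\<close> consists
  of what the lower rule created and \<open>v\<close> of its principal formula; derivability of the new
  premises follows from invertibility.\<close>

section \<open>The monoid of nested sequents\<close>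

instantiation nseq :: (type, type) cancel_comm_monoid_add
begin

definition zero_nseq :: "('a, 'b) nseq" where
  "0 = Seq {#} {#} {#}"

fun plus_nseq :: "('a, 'b) nseq \<Rightarrow> ('a, 'b) nseq \<Rightarrow> ('a, 'b) nseq" where
  "Seq \<Gamma> \<Delta> \<Lambda> + Seq \<Gamma>' \<Delta>' \<Lambda>' = Seq (\<Gamma> + \<Gamma>') (\<Delta> + \<Delta>') (\<Lambda> + \<Lambda>')"

fun minus_nseq :: "('a, 'b) nseq \<Rightarrow> ('a, 'b) nseq \<Rightarrow> ('a, 'b) nseq" where
  "Seq \<Gamma> \<Delta> \<Lambda> - Seq \<Gamma>' \<Delta>' \<Lambda>' = Seq (\<Gamma> - \<Gamma>') (\<Delta> - \<Delta>') (\<Lambda> - \<Lambda>')"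

instance
proof
  fix a b c :: "('a, 'b) nseq"
  show "a + b + c = a + (b + c)" "a + b = b + a" "0 + a = a" "a + b - a = b" "a - b - c = a - (b + c)"
    by (cases a; cases b; cases c; simp add: zero_nseq_def ac_simps)+
qed

end

primrec lefts :: "('f, 'x) nseq \<Rightarrow> 'f multiset" where
  "lefts (Seq \<Gamma> \<Delta> \<Lambda>) = \<Gamma>"

primrec rights :: "('f, 'x) nseq \<Rightarrow> 'f multiset" where
  "rights (Seq \<Gamma> \<Delta> \<Lambda>) = \<Delta>"

primrec nests :: "('f, 'x) nseq \<Rightarrow> ('x \<times> ('f, 'x) nseq) multiset" where
  "nests (Seq \<Gamma> \<Delta> \<Lambda>) = \<Lambda>"

lemma sel_zero [simp]: "lefts 0 = {#}" "rights 0 = {#}" "nests 0 = {#}"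
  by (simp_all add: zero_nseq_def)

lemma sel_plus [simp]:
  "lefts (S + T) = lefts S + lefts T"
  "rights (S + T) = rights S + rights T"
  "nests (S + T) = nests S + nests T"
  by (cases S; cases T; simp)+

definition left_fm :: "'f \<Rightarrow> ('f, 'x) nseq" where
  "left_fm f = Seq {#f#} {#} {#}"

definition nest :: "'x \<Rightarrow> ('f, 'x) nseq \<Rightarrow> ('f, 'x) nseq" where
  "nest x S = Seq {#} {#} {#(x, S)#}"

lemma sel_left_fm [simp]:
  "lefts (left_fm f) = {#f#}" "rights (left_fm f) = {#}" "nests (left_fm f) = {#}"
  by (simp_all add: left_fm_def)

lemma sel_nest [simp]:
  "lefts (nest x S) = {#}" "rights (nest x S) = {#}" "nests (nest x S) = {#(x, S)#}"
  by (simp_all add: nest_def)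

text \<open>Only the top level is compared. A nesting counts as one element, made of its index and
  its whole content, so two nestings with the same index and different contents are
  disjoint.\<close>

definition disjoint :: "('f, 'x) nseq \<Rightarrow> ('f, 'x) nseq \<Rightarrow> bool" where
  "disjoint S T \<longleftrightarrow>
     lefts S \<inter># lefts T = {#} \<and> rights S \<inter># rights T = {#} \<and> nests S \<inter># nests T = {#}"

text \<open>At every element one of the counts in \<open>A\<close> and \<open>C\<close> is zero, so
  all of \<open>C\<close> must come from \<open>M\<close>. The truncated difference
  \<open>M - C\<close> is therefore exact and serves as the common remainder.\<close>

lemma multiset_split:
  fixes M :: "'a multiset"
  assumes "M + A = M' + C" and "A \<inter># C = {#}"
  shows "M = (M - C) + C" and "M' = (M - C) + A"
proof -
  have c: "count M x + count A x = count M' x + count C x" for x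
    using assms(1) by (metis count_union)
  have d: "count A x = 0 \<or> count C x = 0" for x
    using assms(2) by (metis count_empty count_inter_mset inf_nat_def min_def)
  show "M = (M - C) + C"
    by (rule multiset_eqI) (use c d in \<open>auto, metis add.right_neutral le_add2 le_add_diff_inverse2\<close>)
  show "M' = (M - C) + A"
    by (rule multiset_eqI) (use c d in \<open>auto, metis add_diff_cancel_right' add.right_neutral diff_zero\<close>)
qed

text \<open>The diamond property behind all commutations: two ways of splitting off disjoint parts
  of one component leave a common remainder, here \<open>B - c\<close>.\<close>

lemma nseq_split:
  assumes "B + u = B' + c" and "disjoint u c"
  obtains D where "B = D + c" and "B' = D + u"
proof -
  have "B = (B - c) + c \<and> B' = (B - c) + u"
    using assms multiset_split[of "lefts B" "lefts u" "lefts B'" "lefts c"]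
      multiset_split[of "rights B" "rights u" "rights B'" "rights c"]
      multiset_split[of "nests B" "nests u" "nests B'" "nests c"]
    by (cases B; cases B'; cases u; cases c) (simp add: disjoint_def)
  then show thesis using that by blast
qed

lemma nest_split:
  assumes "B + nest x S = B' + nest y T"
  obtains "x = y" "S = T" "B = B'"
    | D where "B = D + nest y T" "B' = D + nest x S"
proof (cases "(x, S) = (y, T)")
  case True
  then show thesis using assms that by simp
next
  case False
  then have "disjoint (nest x S) (nest y T)"
    by (auto simp: disjoint_def)
  then show thesis using assms that nseq_split by metis
qed

section \<open>Contexts as iterated sums\<close>

primrec ctx_under :: "('f, 'x) nseq \<Rightarrow> 'x \<Rightarrow> ('f, 'x) ctx \<Rightarrow> ('f, 'x) ctx" where
  "ctx_under (Seq \<Gamma> \<Delta> \<Lambda>) x U = Under \<Gamma> \<Delta> \<Lambda> x U"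

lemma fill_under [simp]: "fill (ctx_under G x U) S = G + nest x (fill U S)"
  by (cases G) (simp add: nest_def)

lemma path_under [simp]: "path (ctx_under G x U) = x # path U"
  by (cases G) simp

lemma ctx_induct [case_names Hole ctx_under]:
  assumes "P Hole" and "\<And>G x U. P U \<Longrightarrow> P (ctx_under G x U)"
  shows "P U"
proof (induction U)
  case (Under \<Gamma> \<Delta> \<Lambda> x U)
  then show ?case using assms(2)[of U "Seq \<Gamma> \<Delta> \<Lambda>" x] by simp
qed (rule assms(1))

text \<open>An extra summand at the root is absorbed by the outermost layer of the context, or by
  \<open>B\<close> if the context is empty. What matters is that \<open>V\<close> and
  \<open>D\<close> are chosen before \<open>v\<close>.\<close>

lemma fill_add_root:
  "\<exists>V D. path V = path U \<and> (\<forall>v. fill U (B + v) + c = fill V (D + v))"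
proof (induction U rule: ctx_induct)
  case Hole
  show ?case by (rule exI[of _ Hole], rule exI[of _ "B + c"]) (simp add: ac_simps)
next
  case (ctx_under G x U)
  show ?case by (rule exI[of _ "ctx_under (G + c) x U"], rule exI[of _ B]) (simp add: ac_simps)
qed


section \<open>Rule patterns\<close>

text \<open>\<open>Flat C ws\<close> replaces the principal part \<open>C\<close> of a component by one of the \<open>ws\<close>. The modal
  left rules keep their principal formula \<open>f\<close>: \<open>Keep f w\<close> adds \<open>w\<close> to the component, and
  \<open>Into f x g\<close> adds \<open>g\<close> on the left of a child nesting with index \<open>x\<close>.\<close>

datatype ('f, 'x) pattern =
    Flat "('f, 'x) nseq" "('f, 'x) nseq list"
  | Keep 'f "('f, 'x) nseq"
  | Into 'f 'x 'f

inductive root_step :: "('f, 'x) pattern \<Rightarrow> ('f, 'x) nseq \<Rightarrow> ('f, 'x) nseq list \<Rightarrow> bool" where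
  flat: "root_step (Flat C ws) (B + C) (map ((+) B) ws)"
| keep: "root_step (Keep f w) (B + left_fm f) [B + left_fm f + w]"
| into: "root_step (Into f x g) (B + left_fm f + nest x S)
           [B + left_fm f + nest x (S + left_fm g)]"

lemma root_step_flatI:
  "S = B + C \<Longrightarrow> Ps = map (\<lambda>w. B + w) ws \<Longrightarrow> root_step (Flat C ws) S Ps"
  by (simp add: root_step.flat)

text \<open>A form of rule application that descends one nesting at a time, suited to induction. The
  path records indices only, together with their labels if the sequent is tagged.\<close>

inductive step ::
  "('f, 'x) pattern \<Rightarrow> 'x list \<Rightarrow> ('f, 'x) nseq \<Rightarrow> ('f, 'x) nseq list \<Rightarrow> bool" for p where
  root: "root_step p S Ps \<Longrightarrow> step p [] S Ps"
| under: "step p ys S Ps \<Longrightarrow> step p (y # ys) (B + nest y S) (map (\<lambda>P. B + nest y P) Ps)"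

lemma step_fill:
  assumes "root_step p S Ps"
  shows "step p (path U) (fill U S) (map (fill U) Ps)"
proof (induction U rule: ctx_induct)
  case Hole
  then show ?case using assms by (simp add: step.root cong: map_cong)
next
  case (ctx_under G x U)
  then show ?case using step.under[OF ctx_under, of x G] by (simp add: comp_def)
qed

lemma step_iff_fill:
  "step p ys S Ps \<longleftrightarrow>
     (\<exists>U C Cs. root_step p C Cs \<and> path U = ys \<and> S = fill U C \<and> Ps = map (fill U) Cs)"
  (is "_ \<longleftrightarrow> ?R ys S Ps")
proof
  assume "step p ys S Ps"
  then show "?R ys S Ps"
  proof induction
    case (root S Ps)
    then show ?case by (intro exI[of _ Hole] exI[of _ S] exI[of _ Ps]) (simp cong: map_cong)
  next
    case (under ys S Ps y B)
    then obtain U C Cs where "root_step p C Cs" "path U = ys" "S = fill U C" "Ps = map (fill U) Cs"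
      by blast
    then show ?case
      by (intro exI[of _ "ctx_under B y U"] exI[of _ C] exI[of _ Cs]) (simp add: comp_def)
  qed
qed (auto intro: step_fill)

text \<open>For the modal left rules, neither the kept formula nor the nesting moved into may lie in
  \<open>u\<close>. A \<open>Flat\<close> rule may well consume a formula of \<open>u\<close>, an
  outcome that is treated separately. It is only required to consume no nesting, so that applied
  above a hole it cannot remove the nesting that contains the hole.\<close>

fun avoids :: "('f, 'x) pattern \<Rightarrow> ('f, 'x) nseq \<Rightarrow> bool" where
  "avoids (Flat C ws) u \<longleftrightarrow> nests C = {#}"
| "avoids (Keep f w) u \<longleftrightarrow> f \<notin># lefts u"
| "avoids (Into f x g) u \<longleftrightarrow> f \<notin># lefts u \<and> x \<notin> fst ` set_mset (nests u)"

text \<open>A single list \<open>Ks\<close> describes the premises for all \<open>v\<close> at once.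
  The context may change, since the rule may act outside the hole, but the path to the hole stays
  the same, so a rule at the hole can still be addressed there afterwards.\<close>

definition uniform_step ::
  "('f, 'x) pattern \<Rightarrow> 'x list \<Rightarrow> ('f, 'x) ctx \<Rightarrow> ('f, 'x) nseq \<Rightarrow>
     (('f, 'x) ctx \<times> ('f, 'x) nseq) list \<Rightarrow> bool" where
  "uniform_step p ys U B Ks \<longleftrightarrow>
     (\<forall>(V, D) \<in> set Ks. path V = path U) \<and>
     (\<forall>v. step p ys (fill U (B + v)) (map (\<lambda>(V, D). fill V (D + v)) Ks))"

lemma uniform_stepD:
  "uniform_step p ys U B Ks \<Longrightarrow> step p ys (fill U (B + v)) (map (\<lambda>(V, D). fill V (D + v)) Ks)"
  by (simp add: uniform_step_def)

lemma uniform_root: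
  assumes "\<And>v. root_step p (fill U (B + v)) (map (\<lambda>(V, D). fill V (D + v)) Ks)"
    and "\<forall>(V, D) \<in> set Ks. path V = path U"
  shows "uniform_step p [] U B Ks"
  using assms by (simp add: uniform_step_def step.root)

text \<open>By induction on the context. At the hole, a principal part disjoint from
  \<open>u\<close> lies in \<open>B\<close>, by the diamond property. Above the hole, the
  application either takes place beside the nesting that contains the hole, or enters it, or adds a
  formula to its root. Thus the only obstacle is a \<open>Flat\<close> rule at the hole itself whose
  principal part meets \<open>u\<close>.\<close>

lemma step_uniform_or_overlap:
  assumes "step p ys (fill U (B + u)) Ps"
    and "avoids p u" and "set ys \<inter> fst ` set_mset (nests u) = {}"
  shows "(\<exists>Ks. Ps = map (\<lambda>(V, D). fill V (D + u)) Ks \<and> uniform_step p ys U B Ks)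
    \<or> (\<exists>C ws B'. p = Flat C ws \<and> \<not> disjoint u C \<and> B + u = B' + C
          \<and> Ps = map (\<lambda>w. fill U (B' + w)) ws)"
  using assms
proof (induction U arbitrary: ys Ps rule: ctx_induct)
  case Hole
  from Hole(1) have "step p ys (B + u) Ps" by simp
  then show ?case
  proof cases
    case root
    from root(2) show ?thesis
    proof cases
      case (flat C ws B1)
      show ?thesis
      proof (cases "disjoint u C")
        case True
        with flat(2) obtain D where D: "B = D + C" "B1 = D + u" by (rule nseq_split)
        have "uniform_step p ys Hole B (map (\<lambda>w. (Hole, D + w)) ws)"
          unfolding root(1)
        proof (rule uniform_root)
          fix v
          show "root_step p (fill Hole (B + v)) (map (\<lambda>(V, D). fill V (D + v)) (map (\<lambda>w. (Hole, D + w)) ws))"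
            using flat(1) D by (auto intro!: root_step_flatI[of _ "D + v"] simp: ac_simps)
        qed auto
        moreover have "Ps = map (\<lambda>(V, D). fill V (D + u)) (map (\<lambda>w. (Hole, D + w)) ws)"
          using flat(3) D by (simp add: ac_simps)
        ultimately show ?thesis by blast
      next
        case False
        then show ?thesis using flat by (intro disjI2) (auto intro!: exI[of _ B1])
      qed
    next
      case (keep f w B1)
      have "disjoint u (left_fm f)"
        using Hole(2) keep(1) by (auto simp: disjoint_def)
      with keep(2) obtain D where D: "B = D + left_fm f" "B1 = D + u" by (rule nseq_split)
      have "uniform_step p ys Hole B [(Hole, D + left_fm f + w)]"
        unfolding root(1)
      proof (rule uniform_root)
        fix v
        show "root_step p (fill Hole (B + v)) (map (\<lambda>(V, D). fill V (D + v)) [(Hole, D + left_fm f + w)])"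
          using root_step.keep[of f w "D + v"] keep(1) D by (simp add: ac_simps)
      qed auto
      moreover have "Ps = map (\<lambda>(V, D). fill V (D + u)) [(Hole, D + left_fm f + w)]"
        using keep(3) D by (simp add: ac_simps)
      ultimately show ?thesis by blast
    next
      case (into f x g B1 S)
      have "disjoint u (left_fm f + nest x S)"
        using Hole(2) into(1) by (force simp: disjoint_def)
      moreover have "B + u = B1 + (left_fm f + nest x S)" using into(2) by (simp add: ac_simps)
      ultimately obtain D where D: "B = D + (left_fm f + nest x S)" "B1 = D + u"
        using nseq_split by blast
      let ?Ks = "[(Hole, D + left_fm f + nest x (S + left_fm g))]"
      have "uniform_step p ys Hole B ?Ks"
        unfolding root(1)
      proof (rule uniform_root)
        fix v
        show "root_step p (fill Hole (B + v)) (map (\<lambda>(V, D). fill V (D + v)) ?Ks)"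
          using root_step.into[of f x g "D + v" S] into(1) D by (simp add: ac_simps)
      qed auto
      moreover have "Ps = map (\<lambda>(V, D). fill V (D + u)) ?Ks"
        using into(3) D by (simp add: ac_simps)
      ultimately show ?thesis by blast
    qed
  next
    case (under zs S Qs y B1)
    \<comment> \<open>The path starts with \<open>y\<close>, and by assumption no nesting of
      \<open>u\<close> has an index on the path.\<close>
    have "disjoint u (nest y S)"
      using Hole(3) under(1) by (force simp: disjoint_def)
    with under(2) obtain D where D: "B = D + nest y S" "B1 = D + u" by (rule nseq_split)
    let ?Ks = "map (\<lambda>P. (Hole, D + nest y P)) Qs"
    have "step p ys (fill Hole (B + v)) (map (\<lambda>(V, D). fill V (D + v)) ?Ks)" for v
      using step.under[OF under(4), of y "D + v"] under(1) D by (simp add: ac_simps comp_def)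
    then have "uniform_step p ys Hole B ?Ks"
      by (auto simp: uniform_step_def)
    moreover have "Ps = map (\<lambda>(V, D). fill V (D + u)) ?Ks"
      using under(3) D by (simp add: ac_simps)
    ultimately show ?thesis by blast
  qed
next
  case (ctx_under G x U)
  let ?t = "fill U (B + u)"
  from ctx_under(2) have "step p ys (G + nest x ?t) Ps" by simp
  then show ?case
  proof cases
    case root
    from root(2) show ?thesis
    proof cases
      case (flat C ws B1)
      \<comment> \<open>The principal part has no nestings, so the nesting with the hole belongs to
        the untouched remainder.\<close>
      have "disjoint (nest x ?t) C"
        using ctx_under(3) flat(1) by (simp add: disjoint_def)
      with flat(2) obtain D where D: "G = D + C" "B1 = D + nest x ?t" by (rule nseq_split)
      let ?Ks = "map (\<lambda>w. (ctx_under (D + w) x U, B)) ws"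
      have "uniform_step p ys (ctx_under G x U) B ?Ks"
        unfolding root(1)
      proof (rule uniform_root)
        fix v
        show "root_step p (fill (ctx_under G x U) (B + v)) (map (\<lambda>(V, D). fill V (D + v)) ?Ks)"
          using flat(1) D
          by (auto intro!: root_step_flatI[of _ "D + nest x (fill U (B + v))"] simp: ac_simps)
      qed auto
      moreover have "Ps = map (\<lambda>(V, D). fill V (D + u)) ?Ks"
        using flat(3) D by (simp add: ac_simps)
      ultimately show ?thesis by blast
    next
      case (keep f w B1)
      have "disjoint (nest x ?t) (left_fm f)"
        by (simp add: disjoint_def)
      with keep(2) obtain D where D: "G = D + left_fm f" "B1 = D + nest x ?t" by (rule nseq_split)
      let ?Ks = "[(ctx_under (G + w) x U, B)]"
      have "uniform_step p ys (ctx_under G x U) B ?Ks"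
        unfolding root(1)
      proof (rule uniform_root)
        fix v
        show "root_step p (fill (ctx_under G x U) (B + v)) (map (\<lambda>(V, D). fill V (D + v)) ?Ks)"
          using root_step.keep[of f w "D + nest x (fill U (B + v))"] keep(1) D
          by (simp add: ac_simps)
      qed auto
      moreover have "Ps = map (\<lambda>(V, D). fill V (D + u)) ?Ks"
        using keep(3) D by (simp add: ac_simps)
      ultimately show ?thesis by blast
    next
      case (into f y g B1 S)
      from into(2) consider (same) "x = y" "?t = S" "G = B1 + left_fm f"
        | (other) D where "G = D + nest y S" "B1 + left_fm f = D + nest x ?t"
        by (rule nest_split)
      then show ?thesis
      proof cases
        case same
        \<comment> \<open>The formula is moved into the very nesting that contains the hole. It
          arrives at the root of that nesting, where the context can absorb it.\<close>
        obtain V D where V: "path V = path U" "\<And>v. fill U (B + v) + left_fm g = fill V (D + v)"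
          using fill_add_root by metis
        let ?Ks = "[(ctx_under G x V, D)]"
        have "uniform_step p ys (ctx_under G x U) B ?Ks"
          unfolding root(1)
        proof (rule uniform_root)
          fix v
          show "root_step p (fill (ctx_under G x U) (B + v)) (map (\<lambda>(V, D). fill V (D + v)) ?Ks)"
            using root_step.into[of f y g B1 "fill U (B + v)"] into(1) same
            by (simp add: V(2)[symmetric])
        qed (simp add: V)
        moreover have "Ps = map (\<lambda>(V, D). fill V (D + u)) ?Ks"
          using into(3) same(1,3) by (simp add: same(2)[symmetric] V(2)[symmetric])
        ultimately show ?thesis by blast
      next
        case other
        have "disjoint (left_fm f) (nest x ?t)" by (simp add: disjoint_def)
        with other(2) obtain D' where D': "B1 = D' + nest x ?t" "D = D' + left_fm f"
          by (rule nseq_split)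
        let ?Ks = "[(ctx_under (D + nest y (S + left_fm g)) x U, B)]"
        have "uniform_step p ys (ctx_under G x U) B ?Ks"
          unfolding root(1)
        proof (rule uniform_root)
          fix v
          show "root_step p (fill (ctx_under G x U) (B + v)) (map (\<lambda>(V, D). fill V (D + v)) ?Ks)"
            using root_step.into[of f y g "D' + nest x (fill U (B + v))" S] into(1) other(1) D'
            by (simp add: ac_simps)
        qed simp
        moreover have "Ps = map (\<lambda>(V, D). fill V (D + u)) ?Ks"
          using into(3) D' by (simp add: ac_simps)
        ultimately show ?thesis by blast
      qed
    qed
  next
    case (under zs S Qs y B1)
    from under(2) consider (same) "x = y" "?t = S" "G = B1"
      | (other) D where "G = D + nest y S" "B1 = D + nest x ?t"
      by (rule nest_split)
    then show ?thesis
    proof cases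
      case same
      have "set zs \<inter> fst ` set_mset (nests u) = {}" using ctx_under(4) under(1) by auto
      \<comment> \<open>The path enters the nesting with the hole. This is the only case that needs
        the induction hypothesis, and both of its outcomes survive adding the outer layer.\<close>
      with ctx_under(1)[of zs Qs] ctx_under(3) under(4) same
      consider (uni) Ks where "Qs = map (\<lambda>(V, D). fill V (D + u)) Ks" "uniform_step p zs U B Ks"
        | (overlap) C ws B' where "p = Flat C ws" "\<not> disjoint u C" "B + u = B' + C"
            "Qs = map (\<lambda>w. fill U (B' + w)) ws"
        by blast
      then show ?thesis
      proof cases
        case uni
        let ?Ks = "map (\<lambda>(V, D). (ctx_under G x V, D)) Ks"
        have "step p ys (fill (ctx_under G x U) (B + v)) (map (\<lambda>(V, D). fill V (D + v)) ?Ks)" for v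
          using step.under[OF uniform_stepD[OF uni(2)], of x G v] under(1) same
          by (simp add: comp_def case_prod_beta)
        then have "uniform_step p ys (ctx_under G x U) B ?Ks"
          using uni(2) by (auto simp: uniform_step_def)
        moreover have "Ps = map (\<lambda>(V, D). fill V (D + u)) ?Ks"
          using under(3) same uni(1) by (simp add: comp_def case_prod_beta)
        ultimately show ?thesis by blast
      next
        case overlap
        then show ?thesis
          using under(3) same by (intro disjI2) (auto intro!: exI[of _ B'])
      qed
    next
      case other
      let ?Ks = "map (\<lambda>P. (ctx_under (D + nest y P) x U, B)) Qs"
      have "step p ys (fill (ctx_under G x U) (B + v)) (map (\<lambda>(V, D). fill V (D + v)) ?Ks)" for v
        using step.under[OF under(4), of y "D + nest x (fill U (B + v))"] under(1) other
        by (simp add: comp_def ac_simps)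
      then have "uniform_step p ys (ctx_under G x U) B ?Ks"
        by (auto simp: uniform_step_def)
      moreover have "Ps = map (\<lambda>(V, D). fill V (D + u)) ?Ks"
        using under(3) other by (simp add: ac_simps)
      ultimately show ?thesis by blast
    qed
  qed
qed

section \<open>The rules as patterns\<close>

text \<open>The local rules stripped of their side formulae and side nestings. Each pattern holds
  exactly the tagged material that the rule inspects or creates.\<close>

inductive rule_pattern :: "ns_rule \<Rightarrow> nat list \<Rightarrow> (fm \<times> tag, nat \<times> tag) pattern \<Rightarrow> bool" where
  init: "rule_pattern Init [k, l]
    (Flat (Seq {#(Atom p, Orig k)#} {#(Atom p, Orig l)#} {#}) [])"
| botL: "rule_pattern BotL [k] (Flat (Seq {#(Bot, Orig k)#} {#} {#}) [])"
| andL: "rule_pattern AndL [k]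
    (Flat (Seq {#(And A B, Orig k)#} {#} {#}) [Seq {#(A, Aux), (B, Aux)#} {#} {#}])"
| andR: "rule_pattern AndR [k]
    (Flat (Seq {#} {#(And A B, Orig k)#} {#})
      [Seq {#} {#(A, Aux)#} {#}, Seq {#} {#(B, Aux)#} {#}])"
| orL: "rule_pattern OrL [k]
    (Flat (Seq {#(Or A B, Orig k)#} {#} {#})
      [Seq {#(A, Aux)#} {#} {#}, Seq {#(B, Aux)#} {#} {#}])"
| orR: "rule_pattern OrR [k]
    (Flat (Seq {#} {#(Or A B, Orig k)#} {#}) [Seq {#} {#(A, Aux), (B, Aux)#} {#}])"
| impL: "rule_pattern ImpL [k]
    (Flat (Seq {#(Imp A B, Orig k)#} {#} {#})
      [Seq {#} {#(A, Aux)#} {#}, Seq {#(B, Aux)#} {#} {#}])"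
| impR: "rule_pattern ImpR [k]
    (Flat (Seq {#} {#(Imp A B, Orig k)#} {#}) [Seq {#(A, Aux)#} {#(B, Aux)#} {#}])"
| boxR: "rule_pattern (BoxR i) [k]
    (Flat (Seq {#} {#(Box i A, Orig k)#} {#})
      [Seq {#} {#} {#((i, Aux), Seq {#} {#(A, Aux)#} {#})#}])"
| boxL: "rule_pattern (BoxL i j) [k, l] (Into (Box i A, Orig k) (j, Orig l) (A, Aux))"
| d: "rule_pattern (DRule i j) [k]
    (Keep (Box i A, Orig k) (Seq {#} {#} {#((j, Aux), Seq {#(A, Aux)#} {#} {#})#}))"
| t: "rule_pattern (TRule i) [k] (Keep (Box i A, Orig k) (Seq {#(A, Aux)#} {#} {#}))"
| four: "rule_pattern (FourRule i j) [k, l]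
    (Into (Box i A, Orig k) (j, Orig l) (Box i A, Aux))"

inductive_cases root_step_FlatE: "root_step (Flat C ws) S Ps"
inductive_cases root_step_KeepE: "root_step (Keep f w) S Ps"
inductive_cases root_step_IntoE: "root_step (Into f x g) S Ps"

lemma root_step_simps:
  "root_step (Flat C ws) S Ps \<longleftrightarrow> (\<exists>B. S = B + C \<and> Ps = map (\<lambda>w. B + w) ws)"
  "root_step (Keep f w) S Ps \<longleftrightarrow> (\<exists>B. S = B + left_fm f \<and> Ps = [B + left_fm f + w])"
  "root_step (Into f x g) S Ps \<longleftrightarrow>
     (\<exists>B T. S = B + left_fm f + nest x T \<and> Ps = [B + left_fm f + nest x (T + left_fm g)])"
  by (blast elim!: root_step_FlatE root_step_KeepE root_step_IntoE intro: root_step.intros)+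

text \<open>Turns the search for a remainder into three multiset equations that the simplifier can
  solve.\<close>

lemma nseq_ex: "(\<exists>B :: ('f, 'x) nseq. P B) \<longleftrightarrow> (\<exists>\<Gamma> \<Delta> \<Lambda>. P (Seq \<Gamma> \<Delta> \<Lambda>))"
  by (metis nseq.exhaust)

lemma local_rule_imp_pattern:
  "local_rule r ks C Cs \<Longrightarrow> \<exists>p. rule_pattern r ks p \<and> root_step p C Cs"
proof (induction rule: local_rule.induct)
  case (init k l p \<Gamma> \<Delta> \<Lambda>)
  show ?case
    by (rule exI, rule conjI, rule rule_pattern.init[of k l p])
      (simp add: root_step_simps nseq_ex left_fm_def nest_def)
next
  case (botL k \<Gamma> \<Delta> \<Lambda>)
  show ?case
    by (rule exI, rule conjI, rule rule_pattern.botL[of k])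
      (simp add: root_step_simps nseq_ex left_fm_def nest_def)
next
  case (andL k A B \<Gamma> \<Delta> \<Lambda>)
  show ?case
    by (rule exI, rule conjI, rule rule_pattern.andL[of k A B])
      (simp add: root_step_simps nseq_ex left_fm_def nest_def)
next
  case (andR k \<Gamma> A B \<Delta> \<Lambda>)
  show ?case
    by (rule exI, rule conjI, rule rule_pattern.andR[of k A B])
      (simp add: root_step_simps nseq_ex left_fm_def nest_def)
next
  case (orL k A B \<Gamma> \<Delta> \<Lambda>)
  show ?case
    by (rule exI, rule conjI, rule rule_pattern.orL[of k A B])
      (simp add: root_step_simps nseq_ex left_fm_def nest_def)
next
  case (orR k \<Gamma> A B \<Delta> \<Lambda>)
  show ?case
    by (rule exI, rule conjI, rule rule_pattern.orR[of k A B])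
      (simp add: root_step_simps nseq_ex left_fm_def nest_def)
next
  case (impL k A B \<Gamma> \<Delta> \<Lambda>)
  show ?case
    by (rule exI, rule conjI, rule rule_pattern.impL[of k A B])
      (simp add: root_step_simps nseq_ex left_fm_def nest_def)
next
  case (impR k \<Gamma> A B \<Delta> \<Lambda>)
  show ?case
    by (rule exI, rule conjI, rule rule_pattern.impR[of k A B])
      (simp add: root_step_simps nseq_ex left_fm_def nest_def)
next
  case (boxR i k \<Gamma> A \<Delta> \<Lambda>)
  show ?case
    by (rule exI, rule conjI, rule rule_pattern.boxR[of i k A])
      (simp add: root_step_simps nseq_ex left_fm_def nest_def)
next
  case (boxL i j k l A \<Gamma> \<Delta> \<Sigma> \<Pi> \<Theta> \<Lambda>)
  show ?case
    by (rule exI, rule conjI, rule rule_pattern.boxL[of i j k l A])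
      (simp add: root_step_simps nseq_ex left_fm_def nest_def; blast)
next
  case (d i j k A \<Gamma> \<Delta> \<Lambda>)
  show ?case
    by (rule exI, rule conjI, rule rule_pattern.d[of i j k A])
      (simp add: root_step_simps nseq_ex left_fm_def nest_def)
next
  case (t i k A \<Gamma> \<Delta> \<Lambda>)
  show ?case
    by (rule exI, rule conjI, rule rule_pattern.t[of i k A])
      (simp add: root_step_simps nseq_ex left_fm_def nest_def)
next
  case (four i j k l A \<Gamma> \<Delta> \<Sigma> \<Pi> \<Theta> \<Lambda>)
  show ?case
    by (rule exI, rule conjI, rule rule_pattern.four[of i j k l A])
      (simp add: root_step_simps nseq_ex left_fm_def nest_def; blast)
qed

lemma pattern_imp_local_rule:
  "rule_pattern r ks p \<Longrightarrow> root_step p C Cs \<Longrightarrow> local_rule r ks C Cs"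
  by (induction rule: rule_pattern.induct)
    (auto simp: root_step_simps nseq_ex left_fm_def nest_def intro: local_rule.intros)


lemma tagged_app_iff:
  "tagged_app r ms ks T Ts \<longleftrightarrow>
     (\<exists>p ys. rule_pattern r ks p \<and> map snd ys = map Orig ms \<and> step p ys T Ts)"
  unfolding tagged_app.simps step_iff_fill
  using local_rule_imp_pattern pattern_imp_local_rule by fastforce

section \<open>Transfer between tagged and plain sequents\<close>

lemma map_nseq_plus [simp]: "map_nseq f h (S + T) = map_nseq f h S + map_nseq f h T"
  by (cases S; cases T) simp

lemma map_nseq_left_fm [simp]: "map_nseq f h (left_fm a) = left_fm (f a)"
  by (simp add: left_fm_def)

lemma map_nseq_nest [simp]: "map_nseq f h (nest x S) = nest (h x) (map_nseq f h S)"
  by (simp add: nest_def)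

lemma map_nseq_fill: "map_nseq f h (fill U S) = fill (map_ctx f h U) (map_nseq f h S)"
  by (induction U) auto

lemma path_map_ctx: "path (map_ctx f h U) = map h (path U)"
  by (induction U) auto

text \<open>One arbitrary labelling without \<open>Aux\<close>. It suffices because
  \<open>acts\<close> asks only for the existence of some tagged application.\<close>

definition tag_seq :: "seq \<Rightarrow> tseq" where
  "tag_seq = map_nseq (\<lambda>A. (A, Orig 0)) (\<lambda>i. (i, Orig 0))"

lemma erase_tag_seq [simp]: "map_nseq fst fst (tag_seq S) = S"
  by (simp add: tag_seq_def nseq.map_comp comp_def nseq.map_ident)

abbreviation erase_pattern :: "(fm \<times> tag, nat \<times> tag) pattern \<Rightarrow> (fm, nat) pattern" where
  "erase_pattern \<equiv> map_pattern fst fst"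

lemma root_step_map:
  "root_step p C Cs \<Longrightarrow> root_step (map_pattern f h p) (map_nseq f h C) (map (map_nseq f h) Cs)"
  by (induction rule: root_step.induct) (auto simp: root_step_simps)

lemma root_step_tag:
  assumes "root_step (erase_pattern p) C Cs"
  obtains C' Cs' where "root_step p C' Cs'" "C = erase C'" "Cs = map erase Cs'"
proof (cases p)
  case (Flat D ws)
  with assms obtain B where "C = B + map_nseq fst fst D" "Cs = map (\<lambda>w. B + map_nseq fst fst w) ws"
    by (auto simp: root_step_simps)
  then show thesis
    using that[OF root_step.flat[of D ws "tag_seq B", folded Flat]] by (simp add: erase_def)
next
  case (Keep f w)
  with assms obtain B where "C = B + left_fm (fst f)"
    "Cs = [B + left_fm (fst f) + map_nseq fst fst w]"
    by (auto simp: root_step_simps)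
  then show thesis
    using that[OF root_step.keep[of f w "tag_seq B", folded Keep]] by (simp add: erase_def)
next
  case (Into f x g)
  with assms obtain B T where "C = B + left_fm (fst f) + nest (fst x) T"
    "Cs = [B + left_fm (fst f) + nest (fst x) (T + left_fm (fst g))]"
    by (auto simp: root_step_simps)
  then show thesis
    using that[OF root_step.into[of f x g "tag_seq B" "tag_seq T", folded Into]]
    by (simp add: erase_def)
qed

lemma step_erase:
  assumes "step p ys T Ts"
  shows "step (erase_pattern p) (map fst ys) (erase T) (map erase Ts)"
proof -
  obtain U C Cs where "root_step p C Cs" "path U = ys" "T = fill U C" "Ts = map (fill U) Cs"
    using assms unfolding step_iff_fill by blast
  then show ?thesis
    using step_fill[OF root_step_map[of p C Cs fst fst], of "map_ctx fst fst U"]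
    by (simp add: erase_def map_nseq_fill path_map_ctx comp_def)
qed

text \<open>Eliminates the tags, so that weakening and invertibility can be argued on plain
  sequents. From left to right tags are erased; from right to left the pattern supplies the tags of
  the active parts and everything else may be labelled freely.\<close>

lemma acts_iff:
  "acts r S Ps \<longleftrightarrow> (\<exists>ks p ys. rule_pattern r ks p \<and> step (erase_pattern p) ys S Ps)"
proof
  assume "acts r S Ps"
  then show "\<exists>ks p ys. rule_pattern r ks p \<and> step (erase_pattern p) ys S Ps"
    unfolding acts_def tagged_app_iff using step_erase by blast
next
  assume "\<exists>ks p ys. rule_pattern r ks p \<and> step (erase_pattern p) ys S Ps"
  then obtain ks p U C Cs where p: "rule_pattern r ks p" "root_step (erase_pattern p) C Cs"
    and S: "S = fill U C" "Ps = map (fill U) Cs"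
    unfolding step_iff_fill by blast
  obtain C' Cs' where C: "root_step p C' Cs'" "C = erase C'" "Cs = map erase Cs'"
    using root_step_tag p(2) by blast
  \<comment> \<open>Labelling the whole context with \<open>Orig 0\<close> makes the path consist of
    \<open>Orig\<close> labels, as \<open>tagged_app\<close> demands.\<close>
  let ?V = "map_ctx (\<lambda>A. (A, Orig 0)) (\<lambda>i. (i, Orig 0)) U"
  have V: "map_ctx fst fst ?V = U"
    by (simp add: ctx.map_comp comp_def ctx.map_ident)
  have "tagged_app r (replicate (length (path U)) 0) ks (fill ?V C') (map (fill ?V) Cs')"
    unfolding tagged_app_iff
    using p(1) step_fill[OF C(1), of ?V]
    by (auto simp: path_map_ctx comp_def map_replicate_const intro!: exI)
  moreover have "S = erase (fill ?V C')" "Ps = map erase (map (fill ?V) Cs')"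
    using S C V by (simp_all add: erase_def map_nseq_fill)
  ultimately show "acts r S Ps" unfolding acts_def by blast
qed


section \<open>Well-formedness\<close>

lemma prod_sets: "Basic_BNFs.fsts y = {fst y}" "Basic_BNFs.snds y = {snd y}"
  by (cases y; simp)+

lemma wf_Seq:
  "wf_seq N (Seq \<Gamma> \<Delta> \<Lambda>) \<longleftrightarrow>
     (\<forall>A \<in># \<Gamma> + \<Delta>. indices A \<subseteq> N) \<and> (\<forall>(x, S) \<in># \<Lambda>. x \<in> N \<and> wf_seq N S)"
  by (simp add: wf_seq_def ball_Un case_prod_beta prod_sets) blast

lemma wf_plus [simp]: "wf_seq N (S + T) \<longleftrightarrow> wf_seq N S \<and> wf_seq N T"
  by (cases S; cases T) (auto simp: wf_Seq)

lemma wf_left_fm [simp]: "wf_seq N (left_fm A) \<longleftrightarrow> indices A \<subseteq> N"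
  by (simp add: left_fm_def wf_Seq)

lemma wf_nest [simp]: "wf_seq N (nest x S) \<longleftrightarrow> x \<in> N \<and> wf_seq N S"
  by (simp add: nest_def wf_Seq)

fun wf_pattern :: "nat set \<Rightarrow> (fm, nat) pattern \<Rightarrow> bool" where
  "wf_pattern N (Flat C ws) \<longleftrightarrow> (wf_seq N C \<longrightarrow> (\<forall>w \<in> set ws. wf_seq N w))"
| "wf_pattern N (Keep f w) \<longleftrightarrow> (indices f \<subseteq> N \<longrightarrow> wf_seq N w)"
| "wf_pattern N (Into f x g) \<longleftrightarrow> (indices f \<subseteq> N \<longrightarrow> indices g \<subseteq> N)"

lemma wf_root_step:
  "root_step p C Cs \<Longrightarrow> wf_pattern N p \<Longrightarrow> wf_seq N C \<Longrightarrow> P \<in> set Cs \<Longrightarrow> wf_seq N P"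
  by (induction rule: root_step.induct) auto

lemma wf_step:
  "step p ys S Ps \<Longrightarrow> wf_pattern N p \<Longrightarrow> wf_seq N S \<Longrightarrow> P \<in> set Ps \<Longrightarrow> wf_seq N P"
  by (induction arbitrary: P rule: step.induct) (auto dest: wf_root_step)

text \<open>By the subformula property all created indices come from the principal formula, except
  the nesting index \<open>j\<close> of \<open>DRule\<close>, which lies in \<open>N\<close> by the
  side condition in \<open>ns_rules\<close>.\<close>

lemma wf_rule_pattern:
  "rule_pattern r ks p \<Longrightarrow> r \<in> ns_rules N le F \<Longrightarrow> wf_pattern N (erase_pattern p)"
  by (induction rule: rule_pattern.induct) (auto simp: ns_rules_def wf_Seq)


section \<open>Weakening and invertibility\<close>

lemma derives_mono:
  "derives N le F n S \<Longrightarrow> n \<le> m \<Longrightarrow> derives N le F m S"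
proof (induction arbitrary: m rule: derives.induct)
  case (1 S r Ps n)
  then obtain m' where "m = Suc m'" "n \<le> m'" by (cases m) auto
  with 1 show ?case by (auto intro: derives.intros)
qed

lemma derives_wf: "derives N le F n S \<Longrightarrow> wf_seq N S"
  by (erule derives.cases) simp

lemma derives_step:
  assumes "rule_pattern r ks p" and "r \<in> ns_rules N le F" and "wf_seq N S"
    and "step (erase_pattern p) ys S Ps" and "\<And>P. P \<in> set Ps \<Longrightarrow> derives N le F n P"
  shows "derives N le F (Suc n) S"
proof -
  have "acts r S Ps" unfolding acts_iff using assms(1,4) by blast
  with assms(2,3,5) show ?thesis by (blast intro: derives.intros)
qed

lemma rule_pattern_flat:
  "rule_pattern r ks (Flat C ws) \<Longrightarrow> nests C = {#}"
  by (cases rule: rule_pattern.cases) auto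

section \<open>Height-preserving weakening\<close>

lemma avoids_zero:
  "rule_pattern r ks p \<Longrightarrow> avoids (erase_pattern p) 0"
  by (induction rule: rule_pattern.induct) auto

lemma disjoint_zero [simp]: "disjoint 0 C"
  by (simp add: disjoint_def)

text \<open>By induction on the derivation, with \<open>U\<close> and \<open>B\<close> arbitrary
  because the premises have other contexts. With \<open>u = 0\<close> there is nothing to overlap
  with, so the last rule is uniform and can be repeated with \<open>w\<close> present.\<close>

lemma derives_weaken:
  assumes "derives N le F n (fill U B)" and "wf_seq N (fill U (B + w))"
  shows "derives N le F n (fill U (B + w))"
  using assms
proof (induction n "fill U B" arbitrary: U B rule: derives.induct)
  case (1 r Ps n U B)
  then obtain ks p ys where p: "rule_pattern r ks p" "step (erase_pattern p) ys (fill U B) Ps"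
    by (auto simp: acts_iff)
  then obtain Ks where Ks: "Ps = map (\<lambda>(V, D). fill V (D + 0)) Ks"
      "uniform_step (erase_pattern p) ys U B Ks"
    using step_uniform_or_overlap[of "erase_pattern p" ys U B 0 Ps] avoids_zero[OF p(1)] by auto
  let ?Qs = "map (\<lambda>(V, D). fill V (D + w)) Ks"
  have st: "step (erase_pattern p) ys (fill U (B + w)) ?Qs"
    using Ks(2) by (rule uniform_stepD)
  have "derives N le F n Q" if Q: "Q \<in> set ?Qs" for Q
  proof -
    from Q obtain V D where VD: "(V, D) \<in> set Ks" "Q = fill V (D + w)" by auto
    have "wf_seq N Q"
      using wf_step[OF st wf_rule_pattern[OF p(1) 1(2)] 1(6) Q] .
    then show ?thesis using 1(5)[of V D] VD Ks(1) by force
  qed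
  with p(1) 1(2,6) st show ?case by (blast intro: derives_step)
qed

section \<open>Inversion of rules that consume their principal formula\<close>

lemma sel_map_nseq [simp]:
  "lefts (map_nseq f h S) = image_mset f (lefts S)"
  "nests (map_nseq f h S) = image_mset (map_prod h (map_nseq f h)) (nests S)"
  by (cases S; simp)+

lemma flat_principal_not_box:
  "rule_pattern r ks (Flat C ws) \<Longrightarrow> (Box i A, t) \<notin># lefts C"
  by (cases rule: rule_pattern.cases) auto

lemma kept_principal_box:
  "rule_pattern r ks (Keep f w) \<Longrightarrow> \<exists>i A. fst f = Box i A"
  "rule_pattern r ks (Into f x g) \<Longrightarrow> \<exists>i A. fst f = Box i A"
  by (auto elim: rule_pattern.cases)

text \<open>Rules that keep their principal formula act on a box on the left, whereas no consuming
  rule has such a formula in its principal part.\<close>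

lemma avoids_flat_principal:
  assumes "rule_pattern r ks (Flat C ws)" and "rule_pattern r' ks' p"
  shows "avoids p C" and "avoids (erase_pattern p) (map_nseq fst fst C)"
proof -
  note rule_pattern_flat[OF assms(1)] flat_principal_not_box[OF assms(1)]
  with assms(2) show "avoids p C" "avoids (erase_pattern p) (map_nseq fst fst C)"
    by (cases p; force simp: rule_pattern_flat dest!: kept_principal_box)+
qed

text \<open>The outermost connective and the side determine the rule, and the formula then
  determines the premises. Initial sequents consume only atoms and \<open>BotL\<close> only
  \<open>Bot\<close>, so neither meets a compound principal formula.\<close>

lemma overlapping_patterns_eq:
  assumes "rule_pattern r ks p" and "erase_pattern p = Flat C ws" and "r \<notin> {Init, BotL}"
    and "rule_pattern r' ks' p'" and "erase_pattern p' = Flat C' ws'" and "\<not> disjoint C C'"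
  shows "C' = C \<and> ws' = ws"
  using assms(1,2,3)
  by (cases rule: rule_pattern.cases)
    (use assms(4,5,6) in \<open>cases rule: rule_pattern.cases; simp add: disjoint_def; (clarsimp; fail)?\<close>)+

lemma flat_step_iff:
  "step (Flat C ws) ys S Ps \<longleftrightarrow>
     (\<exists>U B. path U = ys \<and> S = fill U (B + C) \<and> Ps = map (\<lambda>w. fill U (B + w)) ws)"
  (is "_ \<longleftrightarrow> ?R")
proof
  assume "step (Flat C ws) ys S Ps"
  then obtain U B where "path U = ys" "S = fill U (B + C)" "Ps = map (fill U) (map (\<lambda>w. B + w) ws)"
    unfolding step_iff_fill root_step_simps by blast
  then show ?R
    by (intro exI[of _ U] exI[of _ B]) (simp add: comp_def)
next
  assume ?R
  then obtain U B where "path U = ys" "S = fill U (B + C)" "Ps = map (\<lambda>w. fill U (B + w)) ws"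
    by blast
  then show "step (Flat C ws) ys S Ps"
    using step_fill[OF root_step.flat[of C ws B], of U] by (simp add: comp_def)
qed

text \<open>By induction on the derivation. If the last rule leaves \<open>C\<close> alone, it is
  repeated with \<open>w\<close> in place of \<open>C\<close> above the inverted premises. If it
  consumes \<open>C\<close>, the required sequent is already one of its premises.\<close>

lemma derives_invert_flat:
  assumes p: "rule_pattern r ks p" "erase_pattern p = Flat C ws"
    and r: "r \<in> ns_rules N le F"
    and "derives N le F n (fill U (B + C))" and w: "w \<in> set ws"
  shows "derives N le F n (fill U (B + w))"
  using assms(4)
proof (induction n "fill U (B + C)" arbitrary: U B rule: derives.induct)
  case (1 r' Ps n U B)
  then obtain ks' p' ys where p': "rule_pattern r' ks' p'"
    "step (erase_pattern p') ys (fill U (B + C)) Ps"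
    by (auto simp: acts_iff)
  \<comment> \<open>Axioms have no premises, so the existence of \<open>w\<close> excludes
    them.\<close>
  have r': "r \<notin> {Init, BotL}" using p w by (auto elim: rule_pattern.cases)
  obtain C' ws' where C': "p = Flat C' ws'" "C = map_nseq fst fst C'"
    using p(2) by (cases p) auto
  have nests: "nests C = {#}" using C' rule_pattern_flat p(1) by simp
  have st: "step (erase_pattern p) (path U) (fill U (B + C)) (map (\<lambda>w. fill U (B + w)) ws)"
    unfolding p(2) flat_step_iff by blast
  have wf: "wf_seq N (fill U (B + w))"
    by (rule wf_step[OF st wf_rule_pattern[OF p(1) r] 1(1)]) (use w in simp)
  have "avoids (erase_pattern p') C"
    using avoids_flat_principal(2) p(1) p'(1) C' by simp
  moreover have "set ys \<inter> fst ` set_mset (nests C) = {}"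
    using nests by simp
  ultimately
  consider (uni) Ks where "Ps = map (\<lambda>(V, D). fill V (D + C)) Ks"
      "uniform_step (erase_pattern p') ys U B Ks"
    | (overlap) C' ws' B' where "erase_pattern p' = Flat C' ws'" "\<not> disjoint C C'"
        "B + C = B' + C'" "Ps = map (\<lambda>w. fill U (B' + w)) ws'"
    using step_uniform_or_overlap[OF p'(2)] by blast
  then show ?case
  proof cases
    case uni
    have "derives N le F n Q" if Q: "Q \<in> set (map (\<lambda>(V, D). fill V (D + w)) Ks)" for Q
    proof -
      from Q obtain V D where VD: "(V, D) \<in> set Ks" "Q = fill V (D + w)" by auto
      with uni(1) have "fill V (D + C) \<in> set Ps" by force
      then show ?thesis unfolding VD(2) by (rule 1(5))
    qed
    then show ?thesis
      using derives_step[OF p'(1) 1(2) wf uniform_stepD[OF uni(2)]] by blast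
  next
    case overlap
    \<comment> \<open>Cancelling \<open>C\<close> then yields \<open>B' = B\<close>. Which of
      several equal occurrences was consumed makes no difference to the multiset.\<close>
    with overlapping_patterns_eq[OF p r' p'(1)] have "C' = C" "ws' = ws" by blast+
    with overlap w have "fill U (B + w) \<in> set Ps" by auto
    then have "derives N le F n (fill U (B + w))" by (rule 1(4))
    then show ?thesis by (rule derives_mono) simp
  qed
qed

fun additive :: "('f, 'x) pattern \<Rightarrow> bool" where
  "additive (Flat C ws) \<longleftrightarrow> False"
| "additive _ \<longleftrightarrow> True"

primrec added :: "('f, 'x) pattern \<Rightarrow> ('f, 'x) nseq" where
  "added (Flat C ws) = 0"
| "added (Keep f w) = w"
| "added (Into f x g) = left_fm g"

text \<open>Exhibits each premise of a modal left rule as a weakening of the conclusion, which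
  reduces inversion to weakening.\<close>

lemma additive_step:
  assumes "step p ys S Ps" and "additive p" and "P \<in> set Ps"
  shows "\<exists>U B. S = fill U B \<and> P = fill U (B + added p)"
  using assms
proof (induction arbitrary: P rule: step.induct)
  case (root S Ps)
  from root(1) show ?case
  proof cases
    case (keep f w B)
    then show ?thesis using root
      by (intro exI[of _ Hole] exI[of _ "B + left_fm f"]) auto
  next
    case (into f x g B T)
    then show ?thesis using root
      \<comment> \<open>The addition happens in the child nesting, one level below the component in
        which the rule is applied.\<close>
      by (intro exI[of _ "ctx_under (B + left_fm f) x Hole"] exI[of _ T]) auto
  qed (use root in auto)
next
  case (under ys S Ps y B)
  then obtain Q where "Q \<in> set Ps" "P = B + nest y Q" by auto
  with under obtain U D where "S = fill U D" "Q = fill U (D + added p)" by blast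
  then show ?case using \<open>P = _\<close>
    by (intro exI[of _ "ctx_under B y U"] exI[of _ D]) simp
qed

lemma additive_erase [simp]: "additive (map_pattern f h p) \<longleftrightarrow> additive p"
  by (cases p) auto

lemma acts_invertible:
  assumes "r \<in> ns_rules N le F" and "acts r S Ps" and "derives N le F n S" and "P \<in> set Ps"
  shows "derives N le F n P"
proof -
  obtain ks p ys where p: "rule_pattern r ks p" "step (erase_pattern p) ys S Ps"
    using assms(2) by (auto simp: acts_iff)
  show ?thesis
  proof (cases "additive p")
    case True
    then obtain U B where "S = fill U B" "P = fill U (B + added (erase_pattern p))"
      using additive_step[OF p(2) _ assms(4)] by auto
    moreover have "wf_seq N P"
      using wf_step[OF p(2) wf_rule_pattern[OF p(1) assms(1)] derives_wf[OF assms(3)] assms(4)] .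
    ultimately show ?thesis using derives_weaken assms(3) by blast
  next
    case False
    then obtain C ws where C: "erase_pattern p = Flat C ws" by (cases p) auto
    with p(2) assms(4) obtain U B w where "S = fill U (B + C)" "P = fill U (B + w)" "w \<in> set ws"
      by (auto simp: flat_step_iff)
    then show ?thesis using derives_invert_flat[OF p(1) C assms(1)] assms(3) by blast
  qed
qed


section \<open>Permutability\<close>

text \<open>Only the indices of the outermost nestings are constrained: a path of
  \<open>Orig\<close> labels cannot enter a nesting tagged \<open>Aux\<close>, whatever it
  contains.\<close>

definition aux_seq :: "tseq \<Rightarrow> bool" where
  "aux_seq S \<longleftrightarrow> snd ` set_mset (lefts S) \<subseteq> {Aux} \<and> snd ` set_mset (rights S) \<subseteq> {Aux}
     \<and> snd ` fst ` set_mset (nests S) \<subseteq> {Aux}"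

lemma aux_seq_created:
  "rule_pattern r ks p \<Longrightarrow> aux_seq (added p)"
  "rule_pattern r ks (Flat C ws) \<Longrightarrow> w \<in> set ws \<Longrightarrow> aux_seq w"
  by (auto simp: aux_seq_def elim!: rule_pattern.cases)

lemma principal_not_aux:
  "rule_pattern r ks (Flat C ws) \<Longrightarrow>
     Aux \<notin> snd ` set_mset (lefts C) \<and> Aux \<notin> snd ` set_mset (rights C)"
  "rule_pattern r ks (Keep f w) \<Longrightarrow> snd f \<noteq> Aux"
  "rule_pattern r ks (Into f x g) \<Longrightarrow> snd f \<noteq> Aux \<and> snd x \<noteq> Aux"
  by (auto elim!: rule_pattern.cases)

text \<open>Principal formulae, nestings moved into and nestings on the path all carry
  \<open>Orig\<close> tags, so none of them can lie at the top level of \<open>u\<close>. This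
  excludes the overlap.\<close>

lemma step_aux_uniform:
  assumes p: "rule_pattern r ks p" and u: "aux_seq u"
    and "step p ys (fill U (B + u)) Ps" and "map snd ys = map Orig ms"
  shows "\<exists>Ks. uniform_step p ys U B Ks"
proof -
  have l: "snd A = Aux" if "A \<in># lefts u" for A using u that by (auto simp: aux_seq_def)
  have r: "snd A = Aux" if "A \<in># rights u" for A using u that by (auto simp: aux_seq_def)
  have n: "snd x = Aux" if "x \<in> fst ` set_mset (nests u)" for x
    using u that unfolding aux_seq_def by blast
  have "avoids p u"
  proof (cases p)
    case (Flat C ws)
    then show ?thesis using p rule_pattern_flat by auto
  next
    case (Keep f w)
    then have "snd f \<noteq> Aux" using p principal_not_aux(2) by auto
    then show ?thesis using Keep l[of f] by auto
  next
    case (Into f x g)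
    then have "snd f \<noteq> Aux" "snd x \<noteq> Aux" using p principal_not_aux(3) by auto
    then have "f \<notin># lefts u" "x \<notin> fst ` set_mset (nests u)" using l n by blast+
    then show ?thesis using Into by simp
  qed
  moreover have "snd x \<noteq> Aux" if "x \<in> set ys" for x
  proof -
    have "snd x \<in> set (map Orig ms)" unfolding assms(4)[symmetric] using that by simp
    then show ?thesis by auto
  qed
  then have "set ys \<inter> fst ` set_mset (nests u) = {}"
    using n by blast
  moreover have "disjoint u C" if C: "p = Flat C ws" for C ws
  proof -
    have "A \<notin># lefts C" if "A \<in># lefts u" for A
      using principal_not_aux(1) p C l[OF that] by (metis image_eqI)
    moreover have "A \<notin># rights C" if "A \<in># rights u" for A
      using principal_not_aux(1) p C r[OF that] by (metis image_eqI)
    moreover have "nests C = {#}" using p C rule_pattern_flat by blast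
    ultimately show ?thesis by (simp add: disjoint_def disjunct_not_in)
  qed
  ultimately show ?thesis using step_uniform_or_overlap[OF assms(3)] by blast
qed

text \<open>If the first rule consumes its principal part \<open>C\<close>, putting \<open>C\<close>
  back for the created part \<open>w\<close> makes the second rule applicable to \<open>T\<close>
  and leaves \<open>C\<close> in all its premises. If the first rule is additive, dropping the added
  part does the same for the second rule, and a second use of uniformity returns the first
  rule.\<close>

lemma step_permute:
  assumes p1: "rule_pattern r1 ks1 p1" "step p1 ys1 T Ps"
    and p2: "rule_pattern r2 ks2 p2" "step p2 ys2 P Qs" "map snd ys2 = map Orig ms2"
    and P: "P \<in> set Ps"
  shows "\<exists>Qs. step p2 ys2 T Qs \<and> (\<forall>Q \<in> set Qs. \<exists>Rs. step p1 ys1 Q Rs)"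
proof (cases "additive p1")
  case False
  then obtain C ws where C: "p1 = Flat C ws" by (cases p1) auto
  with p1(2) P obtain U B w where U: "path U = ys1" "T = fill U (B + C)" "P = fill U (B + w)"
    and w: "w \<in> set ws"
    by (auto simp: flat_step_iff)
  have "aux_seq w" using aux_seq_created(2) p1(1) C w by blast
  then obtain Ks where Ks: "uniform_step p2 ys2 U B Ks"
    using step_aux_uniform p2 U(3) by blast
  have "\<exists>Rs. step p1 ys1 (fill V (D + C)) Rs" if "(V, D) \<in> set Ks" for V D
  proof -
    \<comment> \<open>The path clause of \<open>uniform_step\<close> ensures that the first rule
      acts at its original place.\<close>
    have "path V = ys1" using that Ks U(1) by (auto simp: uniform_step_def)
    then show ?thesis unfolding C flat_step_iff by blast
  qed
  then show ?thesis
    using uniform_stepD[OF Ks, of C] U(2) by fastforce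
next
  case True
  then obtain U B where U: "T = fill U B" "P = fill U (B + added p1)"
    using additive_step[OF p1(2) _ P] by auto
  then obtain Ks where "uniform_step p2 ys2 U B Ks"
    using step_aux_uniform[OF p2(1) aux_seq_created(1)[OF p1(1)]] p2(2,3) by blast
  then obtain Qs where Qs: "step p2 ys2 T Qs"
    using uniform_stepD[of p2 ys2 U B Ks 0] U(1) by auto
  have "\<exists>Rs. step p1 ys1 Q Rs" if Q: "Q \<in> set Qs" for Q
  proof -
    \<comment> \<open>Here \<open>u\<close> is what the second rule consumes (nothing, if it is
      additive) and \<open>v\<close> what it creates. The original application of \<open>p1\<close>
      to \<open>T\<close> is uniform in \<open>u\<close>, since its kept box on the left cannot be
      consumed by the second rule.\<close>
    obtain U B u v where T: "T = fill U (B + u)" "Q = fill U (B + v)"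
      and u: "avoids p1 u" "nests u = {#}"
    proof (cases "additive p2")
      case True
      then obtain U B where "T = fill U B" "Q = fill U (B + added p2)"
        using additive_step[OF Qs _ Q] by auto
      moreover have "avoids p1 0" using p1(1) \<open>additive p1\<close> by (cases p1) auto
      ultimately show thesis using that[of U B 0 "added p2"] by simp
    next
      case False
      then obtain C ws where C: "p2 = Flat C ws" by (cases p2) auto
      with Qs Q obtain U B w where "T = fill U (B + C)" "Q = fill U (B + w)"
        by (auto simp: flat_step_iff)
      then show thesis
        using that avoids_flat_principal(1) rule_pattern_flat p1(1) p2(1) C by blast
    qed
    have "\<not> (\<exists>C ws. p1 = Flat C ws)" using \<open>additive p1\<close> by auto
    then obtain Ks where "uniform_step p1 ys1 U B Ks"
      using step_uniform_or_overlap[of p1 ys1 U B u Ps] p1(2) T(1) u by auto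
    then show ?thesis using uniform_stepD T(2) by blast
  qed
  then show ?thesis using Qs by blast
qed

section \<open>Derivability of the permuted premises\<close>

lemma tagged_app_invertible:
  assumes "r \<in> ns_rules N le F" and "tagged_app r ms ks T Ts" and "derivable N le F (erase T)"
    and "P \<in> set Ts"
  shows "derivable N le F (erase P)"
proof -
  have "acts r (erase T) (map erase Ts)" using assms(2) by (auto simp: acts_def)
  moreover obtain n where "derives N le F n (erase T)" using assms(3) by (auto simp: derivable_def)
  ultimately show ?thesis
    using acts_invertible[OF assms(1)] assms(4) unfolding derivable_def by fastforce
qed

lemma tagged_app_derivable:
  assumes "r \<in> ns_rules N le F" and "tagged_app r ms ks T Ts" and "wf_seq N (erase T)"
    and "\<And>P. P \<in> set Ts \<Longrightarrow> derivable N le F (erase P)"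
  shows "derivable N le F (erase T)"
proof -
  obtain h where h: "\<And>P. P \<in> set Ts \<Longrightarrow> derives N le F (h P) (erase P)"
    using assms(4) unfolding derivable_def by metis
  \<comment> \<open>The premises are raised to a common height. For an axiom the maximum is over the
    empty set, but then there is no premise to derive.\<close>
  have "derives N le F (Max (h ` set Ts)) (erase P)" if "P \<in> set Ts" for P
    using h[OF that] by (rule derives_mono) (use that in auto)
  moreover have "acts r (erase T) (map erase Ts)" using assms(2) by (auto simp: acts_def)
  ultimately have "derives N le F (Suc (Max (h ` set Ts))) (erase T)"
    by (intro derives.intros[OF assms(3,1)]) auto
  then show ?thesis by (auto simp: derivable_def)
qed

text \<open>The given premises make \<open>T\<close> derivable by \<open>r1\<close>. Inverting
  \<open>r2\<close> on \<open>T\<close>, and then \<open>r1\<close> on each resulting premise, gives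
  the derivability of the rearranged sequents.\<close>

lemma rules_permute_down:
  assumes "r1 \<in> ns_rules N le F" and "r2 \<in> ns_rules N le F"
  shows "permutes_down N le F r2 r1"
  unfolding permutes_down_def
proof (intro allI impI, elim conjE bexE exE)
  fix T Ps ms1 ks1 ms2 ks2 P Qs
  assume wf: "wf_seq N (erase T)" and app1: "tagged_app r1 ms1 ks1 T Ps"
    and der: "\<forall>P \<in> set Ps. derivable N le F (erase P)"
    and P: "P \<in> set Ps" and app2: "tagged_app r2 ms2 ks2 P Qs"
  obtain p1 ys1 where p1: "rule_pattern r1 ks1 p1" "map snd ys1 = map Orig ms1" "step p1 ys1 T Ps"
    using app1 unfolding tagged_app_iff by blast
  obtain p2 ys2 where p2: "rule_pattern r2 ks2 p2" "map snd ys2 = map Orig ms2" "step p2 ys2 P Qs"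
    using app2 unfolding tagged_app_iff by blast
  obtain Qs' where Qs': "step p2 ys2 T Qs'" "\<forall>Q \<in> set Qs'. \<exists>Rs. step p1 ys1 Q Rs"
    using step_permute[OF p1(1,3) p2(1,3,2) P] by blast
  have app2': "tagged_app r2 ms2 ks2 T Qs'"
    unfolding tagged_app_iff using p2(1,2) Qs'(1) by blast
  have "derivable N le F (erase T)"
    using tagged_app_derivable[OF assms(1) app1 wf] der by blast
  then have derQ: "derivable N le F (erase Q)" if "Q \<in> set Qs'" for Q
    using tagged_app_invertible[OF assms(2) app2' _ that] by blast
  have "\<exists>Rs. tagged_app r1 ms1 ks1 Q Rs \<and> (\<forall>R \<in> set Rs. derivable N le F (erase R))"
    if Q: "Q \<in> set Qs'" for Q
  proof -
    obtain Rs where "step p1 ys1 Q Rs" using Qs'(2) Q by blast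
    then have "tagged_app r1 ms1 ks1 Q Rs"
      unfolding tagged_app_iff using p1(1,2) by blast
    then show ?thesis using tagged_app_invertible[OF assms(1) _ derQ[OF Q]] by blast
  qed
  with app2' derQ show "\<exists>Qs. tagged_app r2 ms2 ks2 T Qs \<and>
      (\<forall>Q \<in> set Qs. derivable N le F (erase Q) \<and>
        (\<exists>Rs. tagged_app r1 ms1 ks1 Q Rs \<and> (\<forall>R \<in> set Rs. derivable N le F (erase R))))"
    by blast
qed

lemma weakening_derives:
  assumes "weakening S S'" and "wf_seq N S'" and "derives N le F n S"
  shows "derives N le F n S'"
  using assms(1)
proof cases
  case (1 U \<Gamma> \<Delta> \<Lambda> \<Gamma>' \<Delta>' \<Lambda>')
  then show ?thesis
    using derives_weaken[of N le F n U "Seq \<Gamma> \<Delta> \<Lambda>" "Seq \<Gamma>' \<Delta>' \<Lambda>'"] assms(2,3) by simp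
qed

theorem theorem6:
  fixes N :: "nat set" and le :: "nat rel" and F :: "nat \<Rightarrow> modal_axiom set"
  assumes "description N le F"
  shows "weakening_hp_admissible N le F
    \<and> (\<forall>r \<in> introduction_rules N le F. hp_invertible N le F r)
    \<and> (\<forall>r1 \<in> ns_rules N le F. \<forall>r2 \<in> ns_rules N le F. permutable N le F r1 r2)"
proof (intro conjI ballI)
  show "weakening_hp_admissible N le F"
    unfolding weakening_hp_admissible_def using weakening_derives by blast
  show "hp_invertible N le F r" if "r \<in> introduction_rules N le F" for r
    using that acts_invertible unfolding hp_invertible_def introduction_rules_def by blast
  show "permutable N le F r1 r2" if "r1 \<in> ns_rules N le F" "r2 \<in> ns_rules N le F" for r1 r2
    using that rules_permute_down unfolding permutable_def by blast
qed

end
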